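(* The sequence $(C_p)$ is non-increasing and $\lim\limits_{p \rightarrow \infty} pC_p = \infty$.
   Context: There are $N$ balls $b_1,\dots,b_N$, each colored red or green, with strictly fewer green than red balls (a Red-green coloring). For an integer $0\le p<\frac N2$, the coloring is $p$-equal if exactly $p$ balls are green. A comparison consists of choosing two balls and being told whether or not they have the same color (only "same" or "different" is answered). A method is an adaptive deterministic strategy: each comparison may depend on the answers to the previous ones. $Q(N,p,=)$ is the minimum integer $k$ such that there exists a method which, for every $p$-equal Red-green coloring of the $N$ balls (it being known in advance that the coloring is $p$-equal), determines for sure the color of every ball after at most $k$ comparisons. One sets $B(N,p,=) := N - Q(N,p,=)$. For any positive integer $p$, $I_p$ is the set of values $C\in [0,1]$ for which there exists a constant $D \ge 0$ such that, for every integer $N> 2p$, $B(N,p,=) \ge CN - D$; and $C_p$ is the supremum of $I_p$. *)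

theory Defs
  imports Complex_Main
begin

text \<open>
  The balls are the numbers below \<open>N\<close>, and a coloring is represented by the set of its green balls.
  For \<open>2 * p < N\<close> an element of \<open>p_equal_colorings N p\<close> has strictly fewer green than red balls.
\<close>

definition p_equal_colorings :: "nat \<Rightarrow> nat \<Rightarrow> nat set set" where
  "p_equal_colorings N p = {G. G \<subseteq> {..<N} \<and> card G = p}"

definition same_color :: "nat set \<Rightarrow> nat \<Rightarrow> nat \<Rightarrow> bool" where
  "same_color G i j \<longleftrightarrow> (i \<in> G \<longleftrightarrow> j \<in> G)"

text \<open>
  An adaptive deterministic strategy is a binary decision tree: \<open>Compare i j s d\<close> compares the balls
  \<open>i\<close> and \<open>j\<close> and continues with \<open>s\<close> if the answer is ``same'' and with \<open>d\<close> if it is ``different'';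
  \<open>Answer G\<close> stops and declares \<open>G\<close> to be the set of green balls. Since only the number of comparisons
  on executions with a bounded number of steps matters, finite trees suffice.
\<close>

datatype strategy = Answer "nat set" | Compare nat nat strategy strategy

fun valid_strategy :: "nat \<Rightarrow> strategy \<Rightarrow> bool" where
  "valid_strategy N (Answer G) \<longleftrightarrow> True"
| "valid_strategy N (Compare i j s d) \<longleftrightarrow>
     i < N \<and> j < N \<and> i \<noteq> j \<and> valid_strategy N s \<and> valid_strategy N d"

fun outcome :: "strategy \<Rightarrow> nat set \<Rightarrow> nat set" where
  "outcome (Answer A) G = A"
| "outcome (Compare i j s d) G = (if same_color G i j then outcome s G else outcome d G)"

fun num_comparisons :: "strategy \<Rightarrow> nat set \<Rightarrow> nat" where
  "num_comparisons (Answer A) G = 0"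
| "num_comparisons (Compare i j s d) G =
     Suc (if same_color G i j then num_comparisons s G else num_comparisons d G)"

definition solvable_within :: "nat \<Rightarrow> nat \<Rightarrow> nat \<Rightarrow> bool" where
  "solvable_within N p k \<longleftrightarrow>
     (\<exists>t. valid_strategy N t \<and>
       (\<forall>G\<in>p_equal_colorings N p. outcome t G = G \<and> num_comparisons t G \<le> k))"

text \<open>
  \<open>Q_eq N p\<close> is meaningful only for \<open>2 * p < N\<close>; then comparing one ball with all others shows that
  the set of admissible \<open>k\<close> is nonempty.
\<close>

definition Q_eq :: "nat \<Rightarrow> nat \<Rightarrow> nat" where
  "Q_eq N p = (LEAST k. solvable_within N p k)"

definition B_eq :: "nat \<Rightarrow> nat \<Rightarrow> int" where
  "B_eq N p = int N - int (Q_eq N p)"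

definition I_set :: "nat \<Rightarrow> real set" where
  "I_set p = {C. 0 \<le> C \<and> C \<le> 1 \<and>
     (\<exists>D\<ge>0. \<forall>N>2 * p. real_of_int (B_eq N p) \<ge> C * real N - D)}"

definition C_seq :: "nat \<Rightarrow> real" where
  "C_seq p = Sup (I_set p)"

end

theory Submission imports Defs "HOL-Library.Disjoint_Sets" begin

text \<open>
  Both claims rest on the fact that a red ball costs only \<open>2 * p\<close> comparisons, a constant as \<open>N\<close>
  grows (\<open>identifiable_within_red_ball\<close>).

  Monotonicity: a strategy for \<open>N + 1\<close> balls with \<open>p + 1\<close> green ones can be run on \<open>N\<close> balls with \<open>p\<close>
  green ones by adding an imaginary green ball, whose comparisons are answered by negating those of
  a known red ball (\<open>solvable_within_remove_green\<close>). So every linear saving rate for \<open>p + 1\<close> is one for \<open>p\<close>.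

  Growth of \<open>p * C_p\<close>: if the balls are split into groups of more than \<open>p\<close> balls and compared within the
  groups, every monochromatic group is red, and one comparison per group is saved; this gives only
  \<open>C_p \<ge> 1 / (p + 1)\<close>. To do better, take groups of size about \<open>p / (k + 1)\<close> for a constant \<open>k\<close>. After the
  comparisons within the groups, at most \<open>p\<close> groups turn out to be mixed, and resolving them costs a
  constant. This reveals the total size \<open>n\<close> of the green monochromatic groups, of which
  there are at most \<open>k\<close>. The sizes are chosen as \<open>A + (k + 1) ^ i\<close> for \<open>i < m\<close>: then \<open>n\<close> determines how
  often each size occurs among the green groups, by reading off base \<open>k + 1\<close> digits
  (\<open>perturbed_sums_unique\<close>). Hence only groups of at most \<open>k\<close> of the \<open>m\<close> sizes can be green, and
  only these have to be compared with a red ball; all others are known to be red.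
  With \<open>q\<close> groups of each size this saves \<open>(m - k) * q\<close> comparisons up to a constant
  (\<open>solvable_within_perturbed_groups\<close>). For \<open>m = 2 * k\<close> half of all groups are saved, and their sizes
  are at most \<open>2 * A\<close>, so \<open>C_p \<ge> 1 / (4 * A)\<close> (\<open>C_seq_lower_bound\<close>). As \<open>A\<close> is about \<open>p / (k + 1)\<close>, the
  product \<open>p * C_p\<close> eventually exceeds any given constant when \<open>k\<close> is chosen large.
\<close>

section \<open>Identifying a coloring from a family of candidates\<close>

text \<open>
  This generalizes \<open>solvable_within\<close> from all \<open>p\<close>-equal colorings to the candidates that remain
  after some comparisons, so that a strategy can be assembled from its stages.
\<close>

definition identifiable_within :: "nat \<Rightarrow> nat set set \<Rightarrow> nat \<Rightarrow> bool" where
  "identifiable_within N F k \<longleftrightarrow>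
     (\<exists>t. valid_strategy N t \<and> (\<forall>G\<in>F. outcome t G = G \<and> num_comparisons t G \<le> k))"

lemma solvable_within_iff_identifiable:
  "solvable_within N p k \<longleftrightarrow> identifiable_within N (p_equal_colorings N p) k"
  by (simp add: solvable_within_def identifiable_within_def)

lemma identifiable_within_mono:
  assumes "identifiable_within N F k" "F' \<subseteq> F" "k \<le> k'"
  shows "identifiable_within N F' k'"
  using assms unfolding identifiable_within_def by (meson order_trans subsetD)

lemma identifiable_within_singleton: "F \<subseteq> {G} \<Longrightarrow> identifiable_within N F 0"
  unfolding identifiable_within_def by (rule exI[of _ "Answer G"]) auto

lemma identifiable_within_Compare:
  assumes "i < N" "j < N" "i \<noteq> j"
    and "identifiable_within N {G \<in> F. same_color G i j} k"
    and "identifiable_within N {G \<in> F. \<not> same_color G i j} k"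
  shows "identifiable_within N F (Suc k)"
proof -
  obtain s where s: "valid_strategy N s"
      "\<forall>G\<in>{G \<in> F. same_color G i j}. outcome s G = G \<and> num_comparisons s G \<le> k"
    using assms(4) unfolding identifiable_within_def by blast
  obtain d where d: "valid_strategy N d"
      "\<forall>G\<in>{G \<in> F. \<not> same_color G i j}. outcome d G = G \<and> num_comparisons d G \<le> k"
    using assms(5) unfolding identifiable_within_def by blast
  show ?thesis
    unfolding identifiable_within_def
    by (rule exI[of _ "Compare i j s d"]) (use assms(1-3) s d in auto)
qed

definition same_answers :: "(nat \<times> nat) set \<Rightarrow> nat set \<Rightarrow> nat set \<Rightarrow> bool" where
  "same_answers E G H \<longleftrightarrow> (\<forall>(i, j)\<in>E. same_color G i j = same_color H i j)"

text \<open>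
  The strategies below ask a few nonadaptive batches of questions. The answers to a batch \<open>E\<close> single
  out one class of \<open>same_answers E\<close>, and as \<open>k\<close> bounds the cost of every class separately, the
  continuation may depend on those answers.
\<close>

lemma identifiable_within_batch:
  assumes "finite E" "\<And>i j. (i, j) \<in> E \<Longrightarrow> i < N \<and> j < N \<and> i \<noteq> j"
    and "\<And>H. H \<in> F \<Longrightarrow> identifiable_within N {G \<in> F. same_answers E G H} k"
  shows "identifiable_within N F (card E + k)"
  using assms
proof (induction E arbitrary: F rule: finite_induct)
  case empty
  show ?case
  proof (cases "F = {}")
    case True
    then show ?thesis by (simp add: identifiable_within_def) (metis valid_strategy.simps(1))
  next
    case False
    then obtain H where "H \<in> F" by blast
    from empty(2)[OF this] show ?thesis by (simp add: same_answers_def)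
  qed
next
  case (insert e E)
  obtain i j where e: "e = (i, j)" by force
  have ij: "i < N" "j < N" "i \<noteq> j" using insert.prems(1) e by blast+
  have half: "identifiable_within N {G \<in> F. same_color G i j = c} (card E + k)" for c
  proof (rule insert.IH)
    fix H assume H: "H \<in> {G \<in> F. same_color G i j = c}"
    have "{G \<in> {G \<in> F. same_color G i j = c}. same_answers E G H} =
          {G \<in> F. same_answers (insert e E) G H}"
      using H by (auto simp: same_answers_def e)
    then show "identifiable_within N {G \<in> {G \<in> F. same_color G i j = c}. same_answers E G H} k"
      using insert.prems(2) H by auto
  qed (use insert.prems(1) in blast)
  show ?case
    using identifiable_within_Compare[OF ij, of F "card E + k"] half[of True] half[of False] insert.hyps
    by simp
qed

text \<open>
  Among \<open>2 * p + 1\<close> balls the red ones are in the majority, so comparing these balls with one of them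
  exhibits a red ball. From then on, one comparison reveals the color of a given ball.
\<close>

lemma identifiable_within_red_ball:
  assumes "2 * p < N" "F \<subseteq> p_equal_colorings N p"
    and red: "\<And>r. r < N \<Longrightarrow> identifiable_within N {G \<in> F. r \<notin> G} k"
  shows "identifiable_within N F (2 * p + k)"
proof -
  define E where "E = Pair (0::nat) ` {1..2 * p}"
  have "card E = 2 * p" unfolding E_def by (simp add: card_image inj_on_def)
  moreover have "identifiable_within N F (card E + k)"
  proof (rule identifiable_within_batch)
    fix H assume "H \<in> F"
    then have H: "H \<subseteq> {..<N}" "card H = p" using assms(2) by (auto simp: p_equal_colorings_def)
    then have finH: "finite H" using finite_subset by blast
    have cd: "card {..2 * p} - card H \<le> card ({..2 * p} - H)" by (rule diff_card_le_card_Diff[OF finH])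
    then have "{..2 * p} - H \<noteq> {}" using H by (intro notI) simp
    then obtain r where r: "r \<le> 2 * p" "r \<notin> H" by auto
    have "r \<notin> G" if G: "G \<in> F" "same_answers E G H" for G
    proof
      assume "r \<in> G"
      have GF: "G \<subseteq> {..<N}" "card G = p" using G assms(2) by (auto simp: p_equal_colorings_def)
      \<comment> \<open>On the first \<open>2 * p + 1\<close> balls, \<open>G\<close> is \<open>H\<close> or its complement; a disagreement at \<open>r\<close> leaves the complement.\<close>
      have flip: "same_color G 0 x = same_color H 0 x" if "x \<le> 2 * p" for x
        using G(2) that by (cases "x = 0") (auto simp: same_answers_def E_def same_color_def)
      have "{..2 * p} - H \<subseteq> G"
        using flip flip[OF r(1)] r(2) \<open>r \<in> G\<close> by (auto simp: same_color_def)
      then have "card ({..2 * p} - H) \<le> p" using GF card_mono finite_subset by blast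
      then show False using cd H by simp
    qed
    then have "{G \<in> F. same_answers E G H} \<subseteq> {G \<in> F. r \<notin> G}" by blast
    then show "identifiable_within N {G \<in> F. same_answers E G H} k"
      using red[of r] r assms(1) identifiable_within_mono by fastforce
  qed (use assms(1) in \<open>auto simp: E_def\<close>)
  ultimately show ?thesis by simp
qed

section \<open>Sorting groups whose sizes have distinguishable sums\<close>

text \<open>
  The family \<open>U\<close> consists of disjoint groups, and each group is compared with its representative.
  Then the balls outside the groups and the representatives of the mixed groups are compared with a
  red ball. What is still open is which of the monochromatic groups are green; their total
  size is known, and by \<open>determined\<close> so is the set of their sizes. Only the groups whose size is in this
  set are compared with the red ball, which costs at most \<open>e\<close>.
  The comparisons within the groups and those of the outside balls number at most \<open>N - card U\<close>, and
  the term \<open>3 * p\<close> pays for the red ball and the representatives of the mixed groups.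
\<close>

lemma solvable_within_by_groups:
  assumes N: "2 * p < N"
    and U: "finite U" "disjoint U" "\<Union>U \<subseteq> {..<N}" "{} \<notin> U"
    and determined: "\<And>X Y. X \<subseteq> U \<Longrightarrow> Y \<subseteq> U \<Longrightarrow> sum card X = sum card Y \<Longrightarrow> sum card X \<le> p \<Longrightarrow>
        card ` X = card ` Y"
    and few: "\<And>X. X \<subseteq> U \<Longrightarrow> sum card X \<le> p \<Longrightarrow> card {g \<in> U. card g \<in> card ` X} \<le> e"
    and k: "N + 3 * p + e \<le> k + card U"
  shows "solvable_within N p k"
proof -
  define rep where "rep g = (SOME x. x \<in> g)" for g :: "nat set"
  have rep: "rep g \<in> g" if "g \<in> U" for g
    unfolding rep_def using that U(4) by (metis some_in_eq)
  have fing: "finite g" if "g \<in> U" for g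
    using that U(3) by (meson Union_upper finite_lessThan finite_subset order_trans)
  have disj: "g = h" if "g \<in> U" "h \<in> U" "x \<in> g" "x \<in> h" for g h x
    using U(2) that by (auto simp: disjoint_def)
  have less_N: "x < N" if "x \<in> g" "g \<in> U" for x g
    using U(3) that by auto
  have U_disjnt: "pairwise disjnt U"
    using U(2) by (simp add: disjoint_def pairwise_def disjnt_def)
  have cardU: "card (\<Union>U) = sum card U"
    by (rule card_Union_disjoint[OF U_disjnt fing])
  define rest where "rest = {..<N} - \<Union>U"
  have card_rest: "card rest = N - sum card U" "sum card U \<le> N"
    using card_mono[OF _ U(3)] card_Diff_subset[OF _ U(3)] finite_subset[OF U(3)]
    by (auto simp: rest_def cardU)
  define inner where "inner = (\<Union>g\<in>U. (\<lambda>x. (x, rep g)) ` (g - {rep g}))"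
  have card_inner: "card inner + card U \<le> sum card U"
  proof -
    have "card inner \<le> (\<Sum>g\<in>U. card ((\<lambda>x. (x, rep g)) ` (g - {rep g})))"
      unfolding inner_def by (rule card_UN_le[OF U(1)])
    also have "\<dots> = (\<Sum>g\<in>U. card g - 1)"
      by (intro sum.cong refl) (auto simp: card_image inj_on_def rep fing)
    finally have "card inner + card U \<le> (\<Sum>g\<in>U. card g - 1) + card U" by simp
    also have "\<dots> = (\<Sum>g\<in>U. (card g - 1) + 1)"
      by (subst sum.distrib) simp
    also have "\<dots> = sum card U"
    proof (rule sum.cong)
      fix g assume "g \<in> U"
      then show "card g - 1 + 1 = card g" using fing U(4) by (metis One_nat_def Suc_eq_plus1 Suc_pred card_gt_0_iff)
    qed simp
    finally show ?thesis .
  qed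
  have "identifiable_within N {G \<in> p_equal_colorings N p. r \<notin> G}
          (card inner + ((card rest + p) + (e + 0)))" if r: "r < N" for r
  proof (rule identifiable_within_batch)
    fix H assume H: "H \<in> {G \<in> p_equal_colorings N p. r \<notin> G}"
    define F where "F = {G \<in> {G \<in> p_equal_colorings N p. r \<notin> G}. same_answers inner G H}"
    have GF: "G \<subseteq> {..<N}" "card G = p" "r \<notin> G" "finite G" if "G \<in> F" for G
      using that finite_subset by (auto simp: F_def p_equal_colorings_def)
    have in_group: "same_color G x (rep g) = same_color H x (rep g)"
      if "G \<in> F" "g \<in> U" "x \<in> g" for G g x
      using that by (cases "x = rep g") (auto simp: F_def same_answers_def inner_def same_color_def)
    define mixed where "mixed = {g \<in> U. \<exists>x\<in>g. \<not> same_color H x (rep g)}"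
    \<comment> \<open>The mixed groups are disjoint and each contains one of the \<open>p\<close> green balls.\<close>
    have card_mixed: "card mixed \<le> p"
    proof -
      define green where "green g = (SOME x. x \<in> g \<inter> H)" for g
      have green: "green g \<in> g \<inter> H" if "g \<in> mixed" for g
      proof -
        have "g \<inter> H \<noteq> {}" using that rep by (auto simp: mixed_def same_color_def)
        then show ?thesis unfolding green_def by (metis some_in_eq)
      qed
      have "inj_on green mixed"
      proof (rule inj_onI)
        fix g h assume gh: "g \<in> mixed" "h \<in> mixed" "green g = green h"
        then have "green g \<in> g" "green g \<in> h" using green[of g] green[of h] by auto
        then show "g = h" using disj[of g h "green g"] gh by (simp add: mixed_def)
      qed
      moreover have "green ` mixed \<subseteq> H" using green by blast
      moreover have "finite H" "card H = p"
        using H finite_subset by (auto simp: p_equal_colorings_def)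
      ultimately show ?thesis by (metis card_inj_on_le)
    qed
    have fin_mixed: "finite mixed" using U(1) by (simp add: mixed_def)
    define W where "W = rest \<union> rep ` mixed"
    have W: "W \<subseteq> {..<N}"
      using less_N rep by (auto simp: W_def rest_def mixed_def)
    have finW: "finite W" using W finite_subset by blast
    have "card W \<le> card rest + card (rep ` mixed)" unfolding W_def by (rule card_Un_le)
    also have "\<dots> \<le> card rest + p"
      using card_image_le[OF fin_mixed, of rep] card_mixed by simp
    finally have cardW: "card W \<le> card rest + p" .
    define outer where "outer = (\<lambda>x. (x, r)) ` (W - {r})"
    have "card outer \<le> card (W - {r})" unfolding outer_def using finW by (simp add: card_image_le)
    also have "\<dots> \<le> card W" using finW by (simp add: card_mono)
    finally have card_outer: "card outer \<le> card rest + p" using cardW by simp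
    have "identifiable_within N F (card outer + (e + 0))"
    proof (rule identifiable_within_batch)
      fix H1 assume H1: "H1 \<in> F"
      define F1 where "F1 = {G \<in> F. same_answers outer G H1}"
      have on_W: "x \<in> G \<longleftrightarrow> x \<in> H1" if "G \<in> F1" "x \<in> W" for G x
        using that GF(3)[of G] GF(3)[OF H1]
        by (cases "x = r") (auto simp: F1_def same_answers_def outer_def same_color_def)
      \<comment> \<open>\<open>V\<close> collects the balls whose colors are known at this point.\<close>
      define V where "V = rest \<union> \<Union>mixed"
      have on_V: "x \<in> G \<longleftrightarrow> x \<in> H1" if G: "G \<in> F1" and x: "x \<in> V" for G x
      proof (cases "x \<in> rest")
        case True
        then show ?thesis using on_W[OF G] by (simp add: W_def)
      next
        case False
        then obtain g where g: "g \<in> mixed" "x \<in> g" using x by (auto simp: V_def)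
        then have "g \<in> U" by (simp add: mixed_def)
        moreover have "rep g \<in> G \<longleftrightarrow> rep g \<in> H1" using on_W[OF G] g by (simp add: W_def)
        ultimately show ?thesis
          using in_group[of G g x] in_group[OF H1, of g x] G g by (auto simp: F1_def same_color_def)
      qed
      define pure where "pure G = {g \<in> U - mixed. rep g \<in> G}" for G :: "nat set"
      have outside_V: "G - V = \<Union>(pure G)" if G: "G \<in> F1" for G
      proof -
        have GF': "G \<in> F" using G by (simp add: F1_def)
        have mono: "x \<in> G \<longleftrightarrow> rep g \<in> G" if "g \<in> U - mixed" "x \<in> g" for g x
          using in_group[OF GF', of g x] that by (auto simp: mixed_def same_color_def)
        show ?thesis
        proof (intro equalityI subsetI)
          fix x assume x: "x \<in> G - V"
          then have "x < N" using GF(1)[OF GF'] by auto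
          then obtain g where "g \<in> U" "x \<in> g" using x by (auto simp: V_def rest_def)
          then show "x \<in> \<Union>(pure G)" using x mono[of g x] by (auto simp: V_def pure_def)
        next
          fix x assume "x \<in> \<Union>(pure G)"
          then obtain g where g: "g \<in> U - mixed" "rep g \<in> G" "x \<in> g" by (auto simp: pure_def)
          have "h = g" if "h \<in> U" "x \<in> h" for h using disj[of h g x] that g by simp
          then have "h \<notin> mixed" if "x \<in> h" for h using that g(1) by (auto simp: mixed_def)
          moreover have "x \<notin> rest" using g by (auto simp: rest_def)
          ultimately have "x \<notin> V" by (auto simp: V_def)
          then show "x \<in> G - V" using mono g by blast
        qed
      qed
      have pure_U: "pure G \<subseteq> U" for G by (auto simp: pure_def)
      have card_outside: "card (G - V) = sum card (pure G)" if "G \<in> F1" for G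
        unfolding outside_V[OF that]
      proof (rule card_Union_disjoint)
        show "pairwise disjnt (pure G)" by (rule pairwise_subset[OF U_disjnt pure_U])
        show "finite g" if "g \<in> pure G" for g using fing pure_U that by blast
      qed
      have sum_pure: "sum card (pure G) = p - card (H1 \<inter> V)" if G: "G \<in> F1" for G
      proof -
        have "G \<inter> V = H1 \<inter> V" using on_V[OF G] by blast
        moreover have "card (G - V) = card G - card (G \<inter> V)"
          by (rule card_Diff_subset_Int) (use G GF(4) in \<open>auto simp: F1_def\<close>)
        ultimately show ?thesis using card_outside[OF G] GF(2)[of G] G by (simp add: F1_def)
      qed
      have H1F1: "H1 \<in> F1" using H1 by (simp add: F1_def same_answers_def)
      have sizes: "card ` pure G = card ` pure H1" if "G \<in> F1" for G
        by (rule determined[OF pure_U pure_U])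
          (use sum_pure[OF that] sum_pure[OF H1F1] in auto)
      define S where "S = {g \<in> U. card g \<in> card ` pure H1}"
      have finS: "finite S" using U(1) by (simp add: S_def)
      define last where "last = (\<lambda>x. (x, r)) ` (rep ` S - {r})"
      have "card last \<le> card (rep ` S - {r})" unfolding last_def using finS by (simp add: card_image_le)
      also have "\<dots> \<le> card (rep ` S)" using finS by (simp add: card_mono)
      also have "\<dots> \<le> card S" using finS by (rule card_image_le)
      also have "\<dots> \<le> e" unfolding S_def by (rule few[OF pure_U]) (use sum_pure[OF H1F1] in simp)
      finally have card_last: "card last \<le> e" .
      have "identifiable_within N F1 (card last + 0)"
      proof (rule identifiable_within_batch)
        fix H2 assume H2: "H2 \<in> F1"
        have "G = H2" if G: "G \<in> F1" "same_answers last G H2" for G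
        proof -
          have r_red: "r \<notin> G" "r \<notin> H2" using GF(3) G(1) H2 by (auto simp: F1_def)
          have rep_S: "rep g \<in> G \<longleftrightarrow> rep g \<in> H2" if "g \<in> S" for g
            using that G(2) r_red
            by (cases "rep g = r") (auto simp: same_answers_def last_def same_color_def)
          have "g \<in> pure G \<longleftrightarrow> g \<in> pure H2" for g
          proof (cases "g \<in> S")
            case True
            then show ?thesis using rep_S by (simp add: pure_def)
          next
            case False
            have "g \<notin> pure K" if "K \<in> F1" for K
              using False sizes[OF that] pure_U[of K] by (auto simp: S_def)
            then show ?thesis using G(1) H2 by blast
          qed
          then have "G - V = H2 - V" using outside_V G(1) H2 by (metis subsetI subset_antisym)
          moreover have "G \<inter> V = H2 \<inter> V" using on_V[OF G(1)] on_V[OF H2] by blast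
          ultimately show ?thesis by blast
        qed
        then show "identifiable_within N {G \<in> F1. same_answers last G H2} 0"
          by (intro identifiable_within_singleton[of _ H2]) blast
      next
        show "finite last" using finS by (simp add: last_def)
      next
        fix i j assume "(i, j) \<in> last"
        then show "i < N \<and> j < N \<and> i \<noteq> j" using r rep less_N by (auto simp: last_def S_def)
      qed
      then show "identifiable_within N {G \<in> F. same_answers outer G H1} (e + 0)"
        unfolding F1_def[symmetric] by (rule identifiable_within_mono) (use card_last in auto)
    next
      show "finite outer" using finW by (simp add: outer_def)
    next
      fix i j assume "(i, j) \<in> outer"
      then show "i < N \<and> j < N \<and> i \<noteq> j" using r W by (auto simp: outer_def)
    qed
    then show "identifiable_within N {G \<in> {G \<in> p_equal_colorings N p. r \<notin> G}. same_answers inner G H}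
                 ((card rest + p) + (e + 0))"
      unfolding F_def[symmetric] by (rule identifiable_within_mono) (use card_outer in auto)
  next
    show "finite inner" unfolding inner_def using U(1) fing by auto
  next
    fix i j assume "(i, j) \<in> inner"
    then show "i < N \<and> j < N \<and> i \<noteq> j" using rep less_N by (auto simp: inner_def)
  qed
  then have "identifiable_within N (p_equal_colorings N p)
      (2 * p + (card inner + ((card rest + p) + (e + 0))))"
    using N by (intro identifiable_within_red_ball) auto
  then show ?thesis
    unfolding solvable_within_iff_identifiable
    by (rule identifiable_within_mono) (rule subset_refl, use k card_inner card_rest in linarith)
qed

section \<open>Group sizes determined by their sum\<close>

lemma ex_disjoint_groups:
  fixes w :: "'i \<Rightarrow> nat" and V :: "'a set"
  assumes "finite I" "finite V" "sum w I \<le> card V"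
  shows "\<exists>f. (\<forall>i\<in>I. f i \<subseteq> V \<and> card (f i) = w i) \<and> disjoint_family_on f I"
  using assms
proof (induction I arbitrary: V rule: finite_induct)
  case empty
  then show ?case by (simp add: disjoint_family_on_def)
next
  case (insert a I)
  then obtain T where T: "T \<subseteq> V" "card T = w a"
    by (metis add_leE obtain_subset_with_card_n sum.insert)
  have "card (V - T) = card V - w a"
    using T insert.prems(1) by (metis card_Diff_subset finite_subset)
  then have "sum w I \<le> card (V - T)" using insert.prems insert.hyps by simp
  then obtain f where f: "\<forall>i\<in>I. f i \<subseteq> V - T \<and> card (f i) = w i" "disjoint_family_on f I"
    using insert.IH[of "V - T"] insert.prems(1) by auto
  show ?case
  proof (intro exI[of _ "f(a := T)"] conjI)
    show "\<forall>i\<in>insert a I. (f(a := T)) i \<subseteq> V \<and> card ((f(a := T)) i) = w i"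
      using f(1) T by auto
    show "disjoint_family_on (f(a := T)) (insert a I)"
      using f insert.hyps(2) unfolding disjoint_family_on_def by (auto simp: disjoint_iff)
  qed
qed

lemma base_digits_unique:
  fixes c d :: "nat \<Rightarrow> nat"
  assumes "(\<Sum>i<m. c i * b ^ i) = (\<Sum>i<m. d i * b ^ i)"
    and "\<And>i. i < m \<Longrightarrow> c i < b" "\<And>i. i < m \<Longrightarrow> d i < b" and "i < m"
  shows "c i = d i"
  using assms
proof (induction m arbitrary: c d i)
  case 0
  then show ?case by simp
next
  case (Suc m)
  have shift: "(\<Sum>i<Suc m. h i * b ^ i) = h 0 + b * (\<Sum>i<m. h (Suc i) * b ^ i)" for h :: "nat \<Rightarrow> nat"
    by (simp add: sum.lessThan_Suc_shift sum_distrib_left mult_ac del: sum.lessThan_Suc)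
  have eq: "c 0 + b * (\<Sum>i<m. c (Suc i) * b ^ i) = d 0 + b * (\<Sum>i<m. d (Suc i) * b ^ i)"
    using Suc.prems(1) unfolding shift .
  have b: "c 0 < b" "d 0 < b" using Suc.prems(2,3) by auto
  have 0: "c 0 = d 0" using arg_cong[OF eq, of "\<lambda>x. x mod b"] b by simp
  then have "(\<Sum>i<m. c (Suc i) * b ^ i) = (\<Sum>i<m. d (Suc i) * b ^ i)" using eq b by simp
  from Suc.IH[OF this] Suc.prems show ?case using 0 by (cases i) auto
qed

text \<open>
  As \<open>A\<close> exceeds the total of the perturbations \<open>(k + 1) ^ i\<close> of at most \<open>k\<close> summands, this total is the
  remainder of the sum modulo \<open>A\<close>, and its digits in base \<open>k + 1\<close> are the multiplicities.
\<close>

lemma perturbed_sums_unique: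
  fixes c d :: "nat \<Rightarrow> nat"
  assumes eq: "(\<Sum>i<m. c i * (A + (k + 1) ^ i)) = (\<Sum>i<m. d i * (A + (k + 1) ^ i))"
    and c: "(\<Sum>i<m. c i) \<le> k" and d: "(\<Sum>i<m. d i) \<le> k"
    and A: "k * (k + 1) ^ m < A" and "i < m"
  shows "c i = d i"
proof -
  have small: "(\<Sum>i<m. h i * (k + 1) ^ i) < A" if "(\<Sum>i<m. h i) \<le> k" for h :: "nat \<Rightarrow> nat"
  proof -
    have "(\<Sum>i<m. h i * (k + 1) ^ i) \<le> (\<Sum>i<m. h i * (k + 1) ^ m)"
      by (intro sum_mono mult_le_mono2 power_increasing) auto
    also have "\<dots> \<le> k * (k + 1) ^ m" using that by (simp add: sum_distrib_right[symmetric])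
    finally show ?thesis using A by simp
  qed
  have split: "(\<Sum>i<m. h i * (A + (k + 1) ^ i)) = A * (\<Sum>i<m. h i) + (\<Sum>i<m. h i * (k + 1) ^ i)"
    for h :: "nat \<Rightarrow> nat"
    by (simp add: distrib_left sum.distrib sum_distrib_left mult.commute)
  have "(A * (\<Sum>i<m. c i) + (\<Sum>i<m. c i * (k + 1) ^ i)) mod A =
        (A * (\<Sum>i<m. d i) + (\<Sum>i<m. d i * (k + 1) ^ i)) mod A"
    using eq unfolding split by simp
  then have "(\<Sum>i<m. c i * (k + 1) ^ i) = (\<Sum>i<m. d i * (k + 1) ^ i)"
    using small[OF c] small[OF d] by simp
  moreover have "h i < k + 1" if "(\<Sum>i<m. h i) \<le> k" "i < m" for h :: "nat \<Rightarrow> nat" and i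
    using that member_le_sum[of i "{..<m}" h] by simp
  ultimately show ?thesis using base_digits_unique[of c "k + 1" m d i] c d \<open>i < m\<close> by blast
qed

text \<open>
  There are \<open>q\<close> groups of each of the \<open>m\<close> sizes. The bound on \<open>p\<close> leaves room for at most \<open>k\<close> green groups,
  so the multiplicities of their sizes are digits in base \<open>k + 1\<close>, and at most \<open>k * q\<close> groups have a
  size that occurs among the green ones.
\<close>

lemma solvable_within_perturbed_groups:
  assumes N: "2 * p < N" and p: "p < (k + 1) * A" and A: "k * (k + 1) ^ m < A" and "1 \<le> k"
    and q: "q * (\<Sum>i<m. A + (k + 1) ^ i) \<le> N" and l: "N + 3 * p + k * q \<le> l + m * q"
  shows "solvable_within N p l"
proof -
  define s where "s i = A + (k + 1) ^ i" for i
  have s_inj: "s i = s j \<longleftrightarrow> i = j" for i j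
    using power_inject_exp[of "k + 1" i j] \<open>1 \<le> k\<close> by (auto simp: s_def)
  have s_pos: "0 < s i" for i by (simp add: s_def)
  define I where "I = {..<m} \<times> {..<q}"
  have sum_I: "(\<Sum>(i, j)\<in>I. s i) = q * (\<Sum>i<m. A + (k + 1) ^ i)"
    by (simp add: I_def sum.cartesian_product[symmetric] sum_distrib_left s_def)
  have "sum (\<lambda>(i, j). s i) I \<le> card {..<N}" using q sum_I by simp
  moreover have "finite I" by (simp add: I_def)
  ultimately obtain f where family: "\<forall>x\<in>I. f x \<subseteq> {..<N} \<and> card (f x) = (case x of (i, j) \<Rightarrow> s i)"
      and f_disjoint: "disjoint_family_on f I"
    using ex_disjoint_groups[of I "{..<N}" "\<lambda>(i, j). s i"] by blast
  have f: "f (i, j) \<subseteq> {..<N}" "card (f (i, j)) = s i" if "(i, j) \<in> I" for i j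
    using bspec[OF family that] by auto
  have f_ne: "f x \<noteq> {}" if "x \<in> I" for x
  proof -
    obtain i j where x: "x = (i, j)" by (cases x)
    show ?thesis using f(2)[of i j] s_pos[of i] that x by auto
  qed
  have f_inj: "inj_on f I"
    using disjoint_family_onD[OF f_disjoint] f_ne by (metis Int_absorb inj_onI)
  define U where "U = f ` I"
  have finU: "finite U" by (simp add: U_def I_def)
  have cardU: "card U = m * q" by (simp add: U_def card_image[OF f_inj]) (simp add: I_def)
  have card_U: "\<exists>i<m. card g = s i" if "g \<in> U" for g
    using that f(2) by (auto simp: U_def I_def)
  have card_kind: "card {g \<in> U. card g = s i} = q" if "i < m" for i
  proof -
    have "{g \<in> U. card g = s i} = f ` ({i} \<times> {..<q})"
      using that f(2) s_inj by (auto simp: U_def I_def image_iff)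
    moreover have "inj_on f ({i} \<times> {..<q})"
      using f_inj by (rule inj_on_subset) (use that in \<open>auto simp: I_def\<close>)
    ultimately show ?thesis by (simp add: card_image card_cartesian_product)
  qed
  define count where "count X i = card {g \<in> X. card g = s i}" for X :: "nat set set" and i
  have count_sum: "(\<Sum>i<m. count X i * h (s i)) = (\<Sum>g\<in>X. h (card g))"
    if "X \<subseteq> U" for X and h :: "nat \<Rightarrow> nat"
  proof -
    have "(\<Sum>g\<in>X. h (card g)) = (\<Sum>t\<in>s ` {..<m}. \<Sum>g\<in>{g \<in> X. card g = t}. h (card g))"
    proof (rule sum.group[symmetric])
      show "finite X" using that finU by (rule finite_subset)
      show "card ` X \<subseteq> s ` {..<m}" using that card_U by blast
    qed simp
    also have "\<dots> = (\<Sum>i<m. \<Sum>g\<in>{g \<in> X. card g = s i}. h (card g))"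
      by (subst sum.reindex) (auto simp: inj_on_def s_inj)
    also have "\<dots> = (\<Sum>i<m. count X i * h (s i))"
      by (intro sum.cong refl) (simp add: count_def)
    finally show ?thesis by simp
  qed
  have few_groups: "card X \<le> k" if "X \<subseteq> U" "sum card X \<le> p" for X
  proof -
    have "A * card X \<le> sum card X"
      using sum_mono[of X "\<lambda>_. A" card] that(1) card_U by (fastforce simp: s_def mult.commute)
    then have "A * card X < A * (k + 1)" using that(2) p by (simp add: mult.commute)
    then show ?thesis by (simp only: mult_less_cancel1) linarith
  qed
  have sizes_count: "card ` X = s ` {i. i < m \<and> count X i \<noteq> 0}" if "X \<subseteq> U" for X
  proof -
    have "finite X" using that finU by (rule finite_subset)
    then have "count X i \<noteq> 0 \<longleftrightarrow> (\<exists>g\<in>X. card g = s i)" for i by (auto simp: count_def)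
    moreover have "\<exists>i<m. card g = s i" if "g \<in> X" for g using card_U \<open>X \<subseteq> U\<close> that by blast
    ultimately show ?thesis by (auto simp: image_iff) metis+
  qed
  show ?thesis
  proof (rule solvable_within_by_groups[OF N finU])
    show "disjoint U"
      unfolding U_def using f_disjoint by (rule disjoint_family_on_disjoint_image)
    show "\<Union>U \<subseteq> {..<N}" using f(1) by (fastforce simp: U_def)
    show "{} \<notin> U" using f_ne by (auto simp: U_def)
    show "card ` X = card ` Y"
      if X: "X \<subseteq> U" and Y: "Y \<subseteq> U" and eq: "sum card X = sum card Y" and le: "sum card X \<le> p" for X Y
    proof -
      have "count X i = count Y i" if "i < m" for i
      proof (rule perturbed_sums_unique[where c = "count X" and d = "count Y", OF _ _ _ A that])
        show "(\<Sum>i<m. count X i * (A + (k + 1) ^ i)) = (\<Sum>i<m. count Y i * (A + (k + 1) ^ i))"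
          using count_sum[OF X, of "\<lambda>x. x"] count_sum[OF Y, of "\<lambda>x. x"] eq by (simp add: s_def)
        show "(\<Sum>i<m. count X i) \<le> k" "(\<Sum>i<m. count Y i) \<le> k"
          using count_sum[OF X, of "\<lambda>_. 1"] count_sum[OF Y, of "\<lambda>_. 1"]
            few_groups[OF X] few_groups[OF Y] eq le by simp_all
      qed
      then show ?thesis using sizes_count[OF X] sizes_count[OF Y] by auto
    qed
    show "card {g \<in> U. card g \<in> card ` X} \<le> k * q" if X: "X \<subseteq> U" "sum card X \<le> p" for X
    proof -
      have fin: "finite X" using X finU finite_subset by blast
      have "{g \<in> U. card g \<in> card ` X} = (\<Union>t\<in>card ` X. {g \<in> U. card g = t})" by auto
      also have "card \<dots> \<le> (\<Sum>t\<in>card ` X. card {g \<in> U. card g = t})"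
        by (rule card_UN_le) (use fin in simp)
      also have "\<dots> = (\<Sum>t\<in>card ` X. q)"
        using X card_U card_kind by (intro sum.cong refl) fastforce
      also have "\<dots> \<le> card X * q" using card_image_le[OF fin, of card] by simp
      also have "\<dots> \<le> k * q" using few_groups[OF X] by simp
      finally show ?thesis .
    qed
    show "N + 3 * p + k * q \<le> l + card U" using l cardU by simp
  qed
qed

section \<open>Removing a green ball\<close>

text \<open>
  The ball \<open>v\<close> is imaginary and green, and \<open>r\<close> is a red ball: comparing a ball with \<open>v\<close> has the opposite
  answer to comparing it with \<open>r\<close>, so the branches are swapped. A comparison of \<open>v\<close> with \<open>r\<close> itself is
  skipped, as its answer is known.
\<close>

fun simulate_green :: "nat \<Rightarrow> nat \<Rightarrow> strategy \<Rightarrow> strategy" where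
  "simulate_green r v (Answer A) = Answer (A - {v})"
| "simulate_green r v (Compare i j s d) =
    (if i = v \<or> j = v then
       let x = (if i = v then j else i) in
       if x = r then simulate_green r v d
       else Compare x r (simulate_green r v d) (simulate_green r v s)
     else Compare i j (simulate_green r v s) (simulate_green r v d))"

lemma valid_simulate_green:
  "valid_strategy (Suc N) t \<Longrightarrow> r < N \<Longrightarrow> valid_strategy N (simulate_green r N t)"
  by (induction t) (auto simp: Let_def)

lemma simulate_green_correct:
  assumes "valid_strategy (Suc N) t" "r \<notin> G" "r < N" "N \<notin> G"
  shows "outcome (simulate_green r N t) G = outcome t (insert N G) - {N}"
    and "num_comparisons (simulate_green r N t) G \<le> num_comparisons t (insert N G)"
  using assms by (induction t) (auto simp: Let_def same_color_def)

lemma solvable_within_remove_green: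
  assumes "solvable_within (Suc N) (Suc p) k" "2 * p < N"
  shows "solvable_within N p (2 * p + k)"
proof -
  obtain t where t: "valid_strategy (Suc N) t"
      "\<And>G. G \<in> p_equal_colorings (Suc N) (Suc p) \<Longrightarrow> outcome t G = G \<and> num_comparisons t G \<le> k"
    using assms(1) unfolding solvable_within_def by blast
  show ?thesis unfolding solvable_within_iff_identifiable
  proof (rule identifiable_within_red_ball[OF assms(2) subset_refl])
    fix r assume r: "r < N"
    show "identifiable_within N {G \<in> p_equal_colorings N p. r \<notin> G} k"
      unfolding identifiable_within_def
    proof (intro exI conjI ballI)
      show "valid_strategy N (simulate_green r N t)" using t(1) r by (rule valid_simulate_green)
      fix G assume "G \<in> {G \<in> p_equal_colorings N p. r \<notin> G}"
      then have G: "G \<subseteq> {..<N}" "card G = p" "r \<notin> G" by (auto simp: p_equal_colorings_def)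
      have NG: "N \<notin> G" using G by auto
      have "finite G" using G finite_subset by blast
      then have "insert N G \<in> p_equal_colorings (Suc N) (Suc p)"
        using G NG by (auto simp: p_equal_colorings_def)
      from t(2)[OF this] show "outcome (simulate_green r N t) G = G"
        and "num_comparisons (simulate_green r N t) G \<le> k"
        using simulate_green_correct[OF t(1) G(3) r NG] NG by auto
    qed
  qed
qed

section \<open>The saving rate\<close>

lemma solvable_within_trivial:
  assumes "2 * p < N"
  shows "solvable_within N p (N + 3 * p)"
  by (rule solvable_within_by_groups[OF assms, where U = "{}" and e = 0]) auto

lemma Q_eq_le: "solvable_within N p k \<Longrightarrow> Q_eq N p \<le> k"
  unfolding Q_eq_def by (rule Least_le)

lemma solvable_within_Q_eq:
  assumes "2 * p < N"
  shows "solvable_within N p (Q_eq N p)"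
  unfolding Q_eq_def by (rule LeastI, rule solvable_within_trivial[OF assms])

lemma B_eq_lower_bound: "2 * p < N \<Longrightarrow> - 3 * int p \<le> B_eq N p"
  using Q_eq_le[OF solvable_within_trivial, of p N] by (simp add: B_eq_def)

lemma B_eq_Suc_le:
  assumes "2 * p + 1 < N"
  shows "B_eq (Suc N) (Suc p) - 1 - 2 * int p \<le> B_eq N p"
  using Q_eq_le[OF solvable_within_remove_green[OF solvable_within_Q_eq]] assms
  by (fastforce simp: B_eq_def)

lemma zero_in_I_set: "0 \<in> I_set p"
proof -
  have "real_of_int (B_eq N p) \<ge> 0 * real N - real (3 * p)" if "2 * p < N" for N
    using B_eq_lower_bound[OF that] by linarith
  then show ?thesis unfolding I_set_def by (simp, intro exI[of _ "real (3 * p)"]) auto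
qed

lemma bdd_above_I_set: "bdd_above (I_set p)"
  unfolding bdd_above_def by (rule exI[of _ 1]) (auto simp: I_set_def)

lemma I_set_Suc_subset: "I_set (Suc p) \<subseteq> I_set p"
proof
  fix C assume "C \<in> I_set (Suc p)"
  then obtain D where C: "0 \<le> C" "C \<le> 1" and "D \<ge> 0"
    and D: "\<And>N. 2 * Suc p < N \<Longrightarrow> real_of_int (B_eq N (Suc p)) \<ge> C * real N - D"
    unfolding I_set_def by blast
  have "real_of_int (B_eq N p) \<ge> C * real N - (D + 5 * real p + 1)" if "2 * p < N" for N
  \<comment> \<open>For \<open>N = 2 * p + 1\<close> an additional green ball would not leave a red majority.\<close>
  proof (cases "2 * p + 1 < N")
    case True
    have "C * real (Suc N) - D \<le> real_of_int (B_eq (Suc N) (Suc p))" using D[of "Suc N"] True by simp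
    moreover have "C * real N \<le> C * real (Suc N)" using C by (simp add: mult_left_mono)
    moreover have "real_of_int (B_eq (Suc N) (Suc p)) - 1 - 2 * real p \<le> real_of_int (B_eq N p)"
      using B_eq_Suc_le[OF True] by linarith
    ultimately show ?thesis by linarith
  next
    case False
    have "C * real N \<le> real N" using C by (simp add: mult_left_le_one_le)
    then show ?thesis using B_eq_lower_bound[OF that] False that \<open>D \<ge> 0\<close> by linarith
  qed
  moreover have "D + 5 * real p + 1 \<ge> 0" using \<open>D \<ge> 0\<close> by simp
  ultimately show "C \<in> I_set p" using C unfolding I_set_def by blast
qed

text \<open>
  Twice as many sizes as there can be green groups are used, so, up to the boundedly many mixed ones,
  at least half of all groups are never compared with a red ball. The average group has at most \<open>2 * A\<close> balls, which gives a saving of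
  about \<open>N / (4 * A)\<close>.
\<close>

lemma C_seq_lower_bound:
  assumes k: "1 \<le> k" and p: "p < (k + 1) * A" and A: "k * (k + 1) ^ (2 * k) < A"
  shows "1 / (4 * real A) \<le> C_seq p"
proof -
  define S where "S = (\<Sum>i<2 * k. A + (k + 1) ^ i)"
  have "(k + 1) ^ i \<le> A" if "i < 2 * k" for i
  proof -
    have "(k + 1) ^ i \<le> k * (k + 1) ^ (2 * k)"
      using mult_le_mono[OF k power_increasing[of i "2 * k" "k + 1"]] that by simp
    then show ?thesis using A by simp
  qed
  then have "S \<le> (\<Sum>i<2 * k. 2 * A)" unfolding S_def by (intro sum_mono) fastforce
  then have S: "S \<le> 4 * k * A" by simp
  have "A > 0" using A by simp
  then have "S > 0" unfolding S_def using k by (intro sum_pos) (auto simp: lessThan_empty_iff)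
  have "real_of_int (B_eq N p) \<ge> 1 / (4 * real A) * real N - real (k + 3 * p)" if N: "2 * p < N" for N
  proof -
    define q where "q = N div S"
    have "solvable_within N p (N + 3 * p + k * q - 2 * k * q)"
    proof (rule solvable_within_perturbed_groups[OF N p A k])
      show "q * (\<Sum>i<2 * k. A + (k + 1) ^ i) \<le> N" unfolding q_def S_def[symmetric] by simp
    qed simp
    then have "Q_eq N p \<le> N + 3 * p + k * q - 2 * k * q" by (rule Q_eq_le)
    moreover have "2 * k * q \<le> N"
    proof -
      have "2 * k = (\<Sum>i<2 * k. 1)" by simp
      also have "\<dots> \<le> S" unfolding S_def by (rule sum_mono) (use \<open>A > 0\<close> in simp)
      finally have "2 * k * q \<le> S * q" by (rule mult_le_mono1)
      also have "\<dots> \<le> N" by (simp add: q_def)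
      finally show ?thesis .
    qed
    ultimately have "Q_eq N p + k * q \<le> N + 3 * p" by (simp add: algebra_simps)
    then have "real (Q_eq N p + k * q) \<le> real (N + 3 * p)" by (simp only: of_nat_le_iff)
    then have "real (k * q) - 3 * real p \<le> real_of_int (B_eq N p)" by (simp add: B_eq_def)
    moreover have "real N \<le> 4 * real A * (real (k * q) + real k)"
    proof -
      have "N = S * q + N mod S" by (simp add: q_def)
      then have "N \<le> S * (q + 1)" using mod_less_divisor[OF \<open>S > 0\<close>, of N] by simp
      also have "\<dots> \<le> 4 * k * A * (q + 1)" using S by (rule mult_le_mono1)
      finally have "real N \<le> real (4 * k * A * (q + 1))" by (simp only: of_nat_le_iff)
      then show ?thesis by (simp add: algebra_simps)
    qed
    then have "real N / (4 * real A) \<le> real (k * q) + real k"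
      using \<open>A > 0\<close> by (simp add: divide_le_eq mult.commute)
    ultimately show ?thesis by simp
  qed
  moreover have "1 / (4 * real A) \<le> 1" using \<open>A > 0\<close> by simp
  ultimately have "1 / (4 * real A) \<in> I_set p"
    unfolding I_set_def by (auto intro!: exI[of _ "real (k + 3 * p)"])
  then show ?thesis unfolding C_seq_def by (rule cSup_upper[OF _ bdd_above_I_set])
qed

theorem proposition5:
  shows "antimono_on {1..} C_seq \<and> filterlim (\<lambda>p. real p * C_seq p) at_top sequentially"
proof
  have "C_seq (Suc p) \<le> C_seq p" for p
    unfolding C_seq_def
    using zero_in_I_set by (intro cSup_subset_mono bdd_above_I_set I_set_Suc_subset) blast
  then have "antimono C_seq" by (rule decseq_SucI)
  then show "antimono_on {1..} C_seq" by (rule monotone_on_subset) simp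
  show "filterlim (\<lambda>p. real p * C_seq p) at_top sequentially"
    unfolding filterlim_at_top
  proof
    fix Z :: real
    obtain k :: nat where kZ: "8 * Z \<le> real k" using real_arch_simple by blast
    define b where "b = k + 1 + 1"
    \<comment> \<open>From \<open>p0\<close> on, \<open>A = p div b + 1\<close> satisfies both hypotheses on \<open>A\<close> in the lower bound, and \<open>b * A \<le> 2 * p\<close>,
      so that \<open>p / (4 * A) \<ge> b / 8\<close>.\<close>
    define M where "M = (k + 1) * b ^ (2 * (k + 1))"
    define p0 where "p0 = b * M"
    have "Z \<le> real p * C_seq p" if p: "p0 \<le> p" for p
    proof -
      define A where "A = p div b + 1"
      have b: "0 < b" by (simp add: b_def)
      have "M \<le> p div b" using div_le_mono[OF p, of b] b by (simp add: p0_def)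
      then have A: "M < A" by (simp add: A_def)
      have "b * A = b * (p div b) + b" by (simp add: A_def)
      moreover have "p < b * (p div b) + b"
        using mult_div_mod_eq[of b p] mod_less_divisor[OF b, of p] by linarith
      ultimately have pA: "p < b * A" by simp
      have "1 / (4 * real A) \<le> C_seq p"
        by (rule C_seq_lower_bound[of "k + 1", OF _ pA[unfolded b_def] A[unfolded M_def b_def]]) simp
      then have "real p * (1 / (4 * real A)) \<le> real p * C_seq p" by (rule mult_left_mono) simp
      moreover have "Z \<le> real p * (1 / (4 * real A))"
      proof -
        have "0 < M" by (simp add: M_def b_def)
        then have "b \<le> p0" by (simp add: p0_def)
        then have "b \<le> p" using p by simp
        moreover have "b * A \<le> p + b" using times_div_less_eq_dividend[of b p] by (simp add: A_def)
        ultimately have "b * A \<le> 2 * p" by linarith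
        then have "real b * real A \<le> 2 * real p" by (metis of_nat_le_iff of_nat_mult of_nat_numeral)
        moreover have "8 * Z * real A \<le> real b * real A"
          using kZ by (intro mult_right_mono) (auto simp: b_def)
        ultimately have "4 * Z * real A \<le> real p" by simp
        then show ?thesis by (simp add: A_def field_simps)
      qed
      ultimately show ?thesis by simp
    qed
    then show "\<forall>\<^sub>F p in sequentially. Z \<le> real p * C_seq p"
      unfolding eventually_sequentially by blast
  qed
qed

end
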